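(* Let a (nondegenerate) tetrahedron have inradius $r$, circumradius $R$, and distance $d$ between its incenter and its circumcenter. If the tetrahedron has a face which is an equilateral triangle and its insphere touches this face at the face's center of rotational symmetry, then $$G = R^2-d^2-3r^2-2rR = 0 .$$
   Context: The Grace-Danielsson inequality states $d^2\le (R+r)(R-3r)$ for every tetrahedron; the quantity $G=R^2-d^2-3r^2-2rR$ is its gap (right side minus left side). The center of rotational symmetry of an equilateral triangle is its centroid. *)

theory Defs
  imports "HOL-Analysis.Analysis"
begin

definition vertices :: "'a::euclidean_space set \<Rightarrow> 'a set" where
  "vertices P = {v. v extreme_point_of P}"

definition equilateral_triangle :: "'a::euclidean_space set \<Rightarrow> bool" where
  "equilateral_triangle F \<longleftrightarrow>
     2 simplex F \<and>
     (\<exists>s. \<forall>x\<in>vertices F. \<forall>y\<in>vertices F. x \<noteq> y \<longrightarrow> dist x y = s)"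

text \<open>The centroid of a simplex is the average of its vertices; for an equilateral
  triangle it is the center of rotational symmetry.\<close>

definition centroid :: "'a::euclidean_space set \<Rightarrow> 'a" where
  "centroid P = (\<Sum>v\<in>vertices P. v) /\<^sub>R real (card (vertices P))"

text \<open>Tangency is to the plane of the face, at a point that belongs to the face itself.\<close>

definition touches_face_at ::
    "'a::euclidean_space \<Rightarrow> real \<Rightarrow> 'a set \<Rightarrow> 'a \<Rightarrow> bool" where
  "touches_face_at p r F t \<longleftrightarrow> t \<in> F \<and> sphere p r \<inter> affine hull F = {t}"

text \<open>The condition \<open>cball p r \<subseteq> T\<close> excludes the exspheres; \<open>r > 0\<close> excludes
  single points.\<close>

definition is_insphere :: "'a::euclidean_space set \<Rightarrow> 'a \<Rightarrow> real \<Rightarrow> bool" where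
  "is_insphere T p r \<longleftrightarrow>
     r > 0 \<and> cball p r \<subseteq> T \<and> (\<forall>F. F facet_of T \<longrightarrow> (\<exists>t. touches_face_at p r F t))"

definition is_circumsphere :: "'a::euclidean_space set \<Rightarrow> 'a \<Rightarrow> real \<Rightarrow> bool" where
  "is_circumsphere T q R \<longleftrightarrow> vertices T \<subseteq> sphere q R"

end

theory Submission imports Defs begin

text \<open>The contact point of the insphere with the equilateral face \<open>abc\<close> is taken as the origin
  \<open>M\<close>, and \<open>P\<close> is the incenter relative to \<open>M\<close>; it is orthogonal to the face. Let \<open>e\<close> be the apex.
  The planes through the sides of \<open>abc\<close> that are tangent to the insphere and different from the
  plane of \<open>abc\<close> are permuted by the rotation of order 3 about the line \<open>MP\<close>, so their common
  point \<open>e\<close> lies on that line: the tetrahedron is a regular pyramid. The lemma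
  \<open>lateral_face_equation\<close> makes this precise by giving the same linear equation for \<open>e\<close> on each of
  the three lateral faces, up to the exchange of \<open>a\<close>, \<open>b\<close> and \<open>c\<close>.

  The circumcenter lies on the same axis, because it is equidistant from \<open>a\<close>, \<open>b\<close> and \<open>c\<close>.
  Write \<open>h *\<^sub>R P\<close> for the apex, \<open>k *\<^sub>R P\<close> for the circumcenter, \<open>w\<close> for the squared circumradius of
  the triangle and \<open>\<rho> = r\<^sup>2\<close>. Tangency of the lateral faces reads \<open>(w - 4 * \<rho>) * h = 2 * w\<close>, and
  equidistance of the circumcenter from \<open>a\<close> and \<open>e\<close> reads \<open>h\<^sup>2 * \<rho> - 2 * h * k * \<rho> = w\<close>. As \<open>h > 0\<close>,
  the second equation implies \<open>k < h\<close>, so that \<open>R = (h - k) * r\<close>. Eliminating \<open>k\<close> then gives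
  \<open>h * G = (w - 4 * \<rho>) * h - 2 * w\<close>, which is 0 by the first equation.\<close>

section \<open>Tangent planes and orthogonal frames\<close>

text \<open>If the radius to \<open>t\<close> were not orthogonal to the line through \<open>t\<close> and \<open>x\<close>, that line would meet
  the sphere in a second point, the mirror image of \<open>t\<close> in the foot of the perpendicular from \<open>p\<close>.\<close>

lemma tangent_plane_orthogonal_radius:
  fixes p t x :: "'a::real_inner"
  assumes tangent: "sphere p r \<inter> affine hull S = {t}" and x: "x \<in> affine hull S"
  shows "(t - p) \<bullet> (x - t) = 0"
proof (rule ccontr)
  let ?u = "t - p" and ?w = "x - t"
  assume neq: "?u \<bullet> ?w \<noteq> 0"
  then have w0: "?w \<bullet> ?w \<noteq> 0"
    by auto
  define s where "s = - 2 * (?u \<bullet> ?w) / (?w \<bullet> ?w)"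
  define y where "y = t + s *\<^sub>R ?w"
  have t: "t \<in> affine hull S" "dist p t = r"
    using tangent by auto
  have "y = (1 - s) *\<^sub>R t + s *\<^sub>R x"
    by (simp add: y_def algebra_simps)
  then have "y \<in> affine hull S"
    using mem_affine[OF affine_affine_hull t(1) x, of "1 - s" s] by simp
  moreover have "(y - p) \<bullet> (y - p) = ?u \<bullet> ?u"
  proof -
    have "y - p = ?u + s *\<^sub>R ?w"
      by (simp add: y_def)
    then have "(y - p) \<bullet> (y - p) = ?u \<bullet> ?u + s * (2 * (?u \<bullet> ?w) + s * (?w \<bullet> ?w))"
      by (simp only: inner_add_left inner_add_right inner_scaleR_left inner_scaleR_right
          inner_commute[of ?w ?u]) (simp add: algebra_simps)
    moreover have "2 * (?u \<bullet> ?w) + s * (?w \<bullet> ?w) = 0"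
      using w0 by (simp add: s_def)
    ultimately show ?thesis
      by simp
  qed
  then have "dist y p = dist t p"
    by (simp only: dist_norm norm_eq)
  then have "dist p y = r"
    using t(2) by (simp add: dist_commute)
  ultimately have "y \<in> sphere p r \<inter> affine hull S"
    by simp
  then have "y = t"
    unfolding tangent by simp
  then show False
    using neq w0 by (auto simp: y_def s_def)
qed

lemma orthogonal_to_frame_eq_0:
  fixes u v n x :: "real^3"
  assumes "u \<noteq> 0" "v \<noteq> 0" "n \<noteq> 0" "u \<bullet> v = 0" "u \<bullet> n = 0" "v \<bullet> n = 0"
    and "x \<bullet> u = 0" "x \<bullet> v = 0" "x \<bullet> n = 0"
  shows "x = 0"
proof (rule ccontr)
  assume "x \<noteq> 0"
  with assms have distinct: "distinct [u, v, n, x]"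
    by auto
  have "pairwise orthogonal {u, v, n, x}"
    using assms by (auto simp: pairwise_def orthogonal_def inner_commute)
  then have "independent {u, v, n, x}"
    using assms \<open>x \<noteq> 0\<close> by (intro pairwise_orthogonal_independent) auto
  then have "card {u, v, n, x} \<le> 3"
    using independent_bound[of "{u, v, n, x}"] by simp
  with distinct show False
    by simp
qed

section \<open>The apex lies on the axis of the equilateral face\<close>

text \<open>The frame of a face with vertices \<open>A\<close>, \<open>B\<close>, \<open>C\<close> relative to its centroid, together with
  a normal vector \<open>P\<close> of its plane. The number \<open>w\<close> is the squared circumradius, so two of the
  vectors \<open>A\<close>, \<open>B\<close>, \<open>C\<close> enclose an angle of 120 degrees.\<close>

definition equilateral_frame ::
    "real \<Rightarrow> real^3 \<Rightarrow> real^3 \<Rightarrow> real^3 \<Rightarrow> real^3 \<Rightarrow> bool" where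
  "equilateral_frame w A B C P \<longleftrightarrow>
     w > 0 \<and> A + B + C = 0 \<and> A \<bullet> A = w \<and> B \<bullet> B = w \<and> C \<bullet> C = w \<and>
     A \<bullet> B = - w / 2 \<and> B \<bullet> C = - w / 2 \<and> C \<bullet> A = - w / 2 \<and>
     P \<noteq> 0 \<and> A \<bullet> P = 0 \<and> B \<bullet> P = 0 \<and> C \<bullet> P = 0"

lemma equilateral_frame_rotate:
  "equilateral_frame w A B C P \<Longrightarrow> equilateral_frame w B C A P"
  unfolding equilateral_frame_def by (auto simp: algebra_simps)

lemma equilateral_frame_expansion:
  assumes frame: "equilateral_frame w A B C P" and x: "x \<bullet> B = x \<bullet> C"
  shows "x = (x \<bullet> A / w) *\<^sub>R A + (x \<bullet> P / (P \<bullet> P)) *\<^sub>R P"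
proof -
  let ?y = "x - (x \<bullet> A / w) *\<^sub>R A - (x \<bullet> P / (P \<bullet> P)) *\<^sub>R P"
  note f = frame[unfolded equilateral_frame_def]
  have "B \<bullet> B \<noteq> B \<bullet> C"
    using f by simp
  then have "B - C \<noteq> 0"
    by auto
  then have "?y = 0"
    using f x
    by (intro orthogonal_to_frame_eq_0[of A "B - C" P])
      (auto simp: inner_diff_left inner_diff_right inner_commute)
  then show ?thesis
    by (simp add: algebra_simps)
qed

text \<open>A point with the same inner product with all three vertices lies on the axis, since these
  inner products add up to 0.\<close>

lemma equidistant_on_axis:
  assumes frame: "equilateral_frame w A B C P" and "x \<bullet> A = x \<bullet> B" "x \<bullet> B = x \<bullet> C"
  shows "x = (x \<bullet> P / (P \<bullet> P)) *\<^sub>R P"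
proof -
  have "x \<bullet> (A + B + C) = 0"
    using frame by (simp add: equilateral_frame_def)
  then have "x \<bullet> A = 0"
    using assms(2,3) by (simp add: inner_add_right)
  then show ?thesis
    using equilateral_frame_expansion[OF frame assms(3)] by simp
qed

text \<open>The sphere with center \<open>P\<close> through the origin touches the plane of \<open>A\<close>, \<open>B\<close>, \<open>C\<close> at the
  origin and the plane of \<open>B\<close>, \<open>C\<close>, \<open>D\<close> at \<open>t\<close>. Then \<open>t\<close> has the same inner product
  \<open>\<tau> = (t \<bullet> t) / 2\<close> with \<open>B\<close>, \<open>C\<close> and \<open>P\<close>, which determines it in the frame. Tangency at \<open>D\<close>
  then gives a linear equation for \<open>D\<close>. The positivity of \<open>t \<bullet> P\<close> tells on which side of the
  face the apex is.\<close>

lemma lateral_face_equation: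
  assumes frame: "equilateral_frame w A B C P" and "t \<noteq> 0"
    and sphere: "(t - P) \<bullet> (t - P) = P \<bullet> P"
    and tangent: "(t - P) \<bullet> (B - t) = 0" "(t - P) \<bullet> (C - t) = 0" "(t - P) \<bullet> (D - t) = 0"
  shows "4 * (P \<bullet> P) * (D \<bullet> A) = (w - 4 * (P \<bullet> P)) * (D \<bullet> P) - 2 * w * (P \<bullet> P)"
    and "t \<bullet> P > 0"
proof -
  note f = frame[unfolded equilateral_frame_def]
  define \<rho> where "\<rho> = P \<bullet> P"
  define \<tau> where "\<tau> = t \<bullet> P"
  have pos: "\<rho> > 0" "w > 0" "t \<bullet> t > 0"
    using f \<open>t \<noteq> 0\<close> by (auto simp: \<rho>_def)
  have tt: "t \<bullet> t = 2 * \<tau>"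
    using sphere by (simp add: \<tau>_def inner_diff_left inner_diff_right inner_commute)
  with pos have \<tau>: "\<tau> > 0"
    by simp
  then show "t \<bullet> P > 0"
    by (simp add: \<tau>_def)
  have tB: "t \<bullet> B = \<tau>" and tC: "t \<bullet> C = \<tau>"
    using tangent(1,2) tt f
    by (simp_all add: \<tau>_def inner_diff_left inner_diff_right inner_commute)
  have "t \<bullet> (A + B + C) = 0"
    using f by simp
  then have tA: "t \<bullet> A = - 2 * \<tau>"
    using tB tC by (simp add: inner_add_right)
  have t: "t = (- 2 * \<tau> / w) *\<^sub>R A + (\<tau> / \<rho>) *\<^sub>R P"
    using equilateral_frame_expansion[OF frame, of t] tA tB tC by (simp add: \<tau>_def \<rho>_def)
  have inner_t: "x \<bullet> t = (- 2 * \<tau> / w) * (x \<bullet> A) + (\<tau> / \<rho>) * (x \<bullet> P)" for x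
    by (subst t) (simp add: inner_add_right inner_diff_right)
  have "2 * \<tau> = (- 2 * \<tau> / w) * (- 2 * \<tau>) + (\<tau> / \<rho>) * \<tau>"
    using inner_t[of t] unfolding tt tA \<tau>_def[symmetric] .
  then have "\<tau> * (\<tau> * (4 * \<rho> + w)) = \<tau> * (2 * w * \<rho>)"
    using pos by (simp add: field_simps)
  then have \<tau>_eq: "\<tau> * (4 * \<rho> + w) = 2 * w * \<rho>"
    using \<tau> by simp
  have "D \<bullet> t - D \<bullet> P - \<tau> = 0"
    using tangent(3) tt by (simp add: \<tau>_def inner_diff_left inner_diff_right inner_commute)
  then have "\<tau> * (w * (D \<bullet> P) - 2 * \<rho> * (D \<bullet> A) - w * \<rho>) = w * \<rho> * (D \<bullet> P)"
    unfolding inner_t using pos by (simp add: field_simps)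
  \<comment> \<open>The factor \<open>4 * \<rho> + w\<close> allows \<open>\<tau>_eq\<close> to eliminate \<open>\<tau>\<close>.\<close>
  then have "(\<tau> * (4 * \<rho> + w)) * (w * (D \<bullet> P) - 2 * \<rho> * (D \<bullet> A) - w * \<rho>)
      = (4 * \<rho> + w) * (w * \<rho> * (D \<bullet> P))"
    by (metis mult.assoc mult.commute)
  then have "(w * \<rho>) * (2 * (w * (D \<bullet> P) - 2 * \<rho> * (D \<bullet> A) - w * \<rho>))
      = (w * \<rho>) * ((4 * \<rho> + w) * (D \<bullet> P))"
    unfolding \<tau>_eq by (simp add: mult_ac)
  then have "2 * (w * (D \<bullet> P) - 2 * \<rho> * (D \<bullet> A) - w * \<rho>) = (4 * \<rho> + w) * (D \<bullet> P)"
    using pos by simp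
  then show "4 * (P \<bullet> P) * (D \<bullet> A) = (w - 4 * (P \<bullet> P)) * (D \<bullet> P) - 2 * w * (P \<bullet> P)"
    unfolding \<rho>_def[symmetric] by (simp add: algebra_simps)
qed

section \<open>The gap of a regular pyramid\<close>

text \<open>In a regular pyramid, all data are determined by the positions \<open>h\<close> and \<open>k\<close> of the apex and
  the circumcenter on the axis. The condition \<open>h > 0\<close> is what distinguishes the insphere from the
  exsphere that touches the base at its centroid: it fixes the sign in \<open>R = (h - k) * r\<close>.\<close>

lemma regular_pyramid_gap_eq_0:
  fixes r R h k w :: real
  assumes "r > 0" "w > 0" "h > 0" "R \<ge> 0"
    and tangent: "(w - 4 * r\<^sup>2) * h = 2 * w"
    and base: "R\<^sup>2 = w + k\<^sup>2 * r\<^sup>2"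
    and apex: "R\<^sup>2 = (h - k)\<^sup>2 * r\<^sup>2"
    and d: "d\<^sup>2 = (k - 1)\<^sup>2 * r\<^sup>2"
  shows "R\<^sup>2 - d\<^sup>2 - 3 * r\<^sup>2 - 2 * r * R = 0"
proof -
  have k: "2 * h * k * r\<^sup>2 = h\<^sup>2 * r\<^sup>2 - w"
    using base apex by (simp add: power2_diff algebra_simps)
  have "2 * h * r\<^sup>2 * (h - k) = h\<^sup>2 * r\<^sup>2 + w"
    using k by (simp add: algebra_simps power2_eq_square)
  also have "\<dots> > 0"
    using assms(1-3) by (intro add_pos_pos) auto
  finally have "2 * h * r\<^sup>2 * (h - k) > 0" .
  moreover have "2 * h * r\<^sup>2 > 0"
    using assms(1,3) by simp
  ultimately have "h - k > 0"
    by (rule zero_less_mult_pos)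
  then have "(h - k) * r \<ge> 0"
    using assms(1) by simp
  then have R: "R = (h - k) * r"
    using apex \<open>R \<ge> 0\<close> by (metis power2_eq_imp_eq power_mult_distrib)
  let ?G = "R\<^sup>2 - d\<^sup>2 - 3 * r\<^sup>2 - 2 * r * R"
  have "?G = w + 4 * k * r\<^sup>2 - 4 * r\<^sup>2 - 2 * r\<^sup>2 * h"
    unfolding base d unfolding R by (simp add: power2_eq_square algebra_simps)
  then have "h * ?G = w * h + 2 * (2 * h * k * r\<^sup>2) - 4 * r\<^sup>2 * h - 2 * r\<^sup>2 * h\<^sup>2"
    by (simp only:) (simp add: power2_eq_square algebra_simps)
  also have "\<dots> = (w - 4 * r\<^sup>2) * h - 2 * w"
    unfolding k by (simp add: algebra_simps)
  finally have "h * ?G = 0"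
    using tangent by simp
  then show ?thesis
    using \<open>h > 0\<close> by simp
qed

section \<open>From the tetrahedron to the frame\<close>

lemma vertices_convex_hull_affine_independent:
  "\<not> affine_dependent S \<Longrightarrow> vertices (convex hull S) = S"
  by (auto simp: vertices_def extreme_point_of_convex_hull_affine_independent)

text \<open>The contact point \<open>t\<close> of a lateral face differs from the centroid of the base: otherwise the
  centroid, and with it the vertex \<open>a = 3 *\<^sub>R M - b - c\<close>, would lie in the plane of the lateral
  face. As \<open>b\<close> and \<open>c\<close> lie at height 0 above the base, a contact point at positive height in the
  face forces the apex to positive height.\<close>

lemma insphere_lateral_face:
  fixes a b c e M p :: "real^3"
  assumes S: "\<not> affine_dependent {a, b, c, e}" "a \<notin> {b, c, e}"
    and M: "a + b + c = 3 *\<^sub>R M"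
    and frame: "equilateral_frame w (a - M) (b - M) (c - M) (p - M)"
    and r: "r = norm (p - M)"
    and touch: "touches_face_at p r (convex hull {b, c, e}) t"
  shows "4 * r\<^sup>2 * ((e - M) \<bullet> (a - M)) = (w - 4 * r\<^sup>2) * ((e - M) \<bullet> (p - M)) - 2 * w * r\<^sup>2"
    and "(e - M) \<bullet> (p - M) > 0"
proof -
  let ?P = "p - M"
  have t: "t \<in> convex hull {b, c, e}" "sphere p r \<inter> affine hull {b, c, e} = {t}"
    using touch by (auto simp: touches_face_at_def)
  have t_aff: "t \<in> affine hull {b, c, e}" and t_sph: "dist p t = r"
    using t(2) by auto
  have bce: "b \<in> affine hull {b, c, e}" "c \<in> affine hull {b, c, e}" "e \<in> affine hull {b, c, e}"
    by (auto intro: hull_inc)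
  have "t \<noteq> M"
  proof
    assume "t = M"
    have "a = 3 *\<^sub>R M + (- 1) *\<^sub>R b + (- 1) *\<^sub>R c"
      using M by (simp add: algebra_simps)
    also have "\<dots> \<in> affine hull {b, c, e}"
      using t_aff bce \<open>t = M\<close> by (intro mem_affine_3 affine_affine_hull) auto
    also have "{b, c, e} = {a, b, c, e} - {a}"
      using S(2) by auto
    finally show False
      using S(1) unfolding affine_dependent_def by blast
  qed
  have tangent: "(t - M - ?P) \<bullet> (x - M - (t - M)) = 0" if "x \<in> affine hull {b, c, e}" for x
    using tangent_plane_orthogonal_radius[OF t(2) that] by simp
  have sphere: "(t - M - ?P) \<bullet> (t - M - ?P) = ?P \<bullet> ?P"
    using t_sph r by (simp add: dist_norm norm_eq[symmetric] norm_minus_commute)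
  have r2: "?P \<bullet> ?P = r\<^sup>2"
    by (simp add: r power2_norm_eq_inner)
  have "t - M \<noteq> 0"
    using \<open>t \<noteq> M\<close> by simp
  note lateral = lateral_face_equation[OF frame this sphere tangent tangent tangent, OF bce]
  show "4 * r\<^sup>2 * ((e - M) \<bullet> (a - M)) = (w - 4 * r\<^sup>2) * ((e - M) \<bullet> ?P) - 2 * w * r\<^sup>2"
    using lateral(1) by (simp add: r2)
  obtain u v s where uvs: "0 \<le> s" "u + v + s = 1" "t = u *\<^sub>R b + v *\<^sub>R c + s *\<^sub>R e"
    using t(1) by (auto simp: convex_hull_3)
  have "t - M = t - (u + v + s) *\<^sub>R M"
    by (simp add: uvs(2))
  also have "\<dots> = u *\<^sub>R (b - M) + v *\<^sub>R (c - M) + s *\<^sub>R (e - M)"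
    by (simp add: uvs(3) algebra_simps)
  finally have "(t - M) \<bullet> ?P = s * ((e - M) \<bullet> ?P)"
    using frame by (simp add: equilateral_frame_def inner_add_left)
  then show "(e - M) \<bullet> ?P > 0"
    using lateral(2) uvs(1) by (simp add: zero_less_mult_iff)
qed

lemma equilateral_frame_centroid:
  fixes a b c M p :: "real^3"
  assumes M: "a + b + c = 3 *\<^sub>R M"
    and s: "dist a b = s" "dist b c = s" "dist c a = s" and "s > 0"
    and "p \<noteq> M" and normal: "\<And>x. x \<in> {a, b, c} \<Longrightarrow> (x - M) \<bullet> (p - M) = 0"
  shows "equilateral_frame (s\<^sup>2 / 3) (a - M) (b - M) (c - M) (p - M)"
proof -
  define A B C where ABC: "A = a - M" "B = b - M" "C = c - M"
  have sum0: "A + B + C = 0"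
    using M by (simp add: ABC vec_eq_iff add.assoc)
  have "A \<bullet> (A + B + C) = 0" "B \<bullet> (A + B + C) = 0" "C \<bullet> (A + B + C) = 0"
    by (simp_all add: sum0)
  moreover from s have "(A - B) \<bullet> (A - B) = s\<^sup>2" "(B - C) \<bullet> (B - C) = s\<^sup>2" "(C - A) \<bullet> (C - A) = s\<^sup>2"
    by (simp_all add: ABC dist_norm flip: power2_norm_eq_inner)
  ultimately have "A \<bullet> A = s\<^sup>2 / 3 \<and> B \<bullet> B = s\<^sup>2 / 3 \<and> C \<bullet> C = s\<^sup>2 / 3 \<and>
      A \<bullet> B = - (s\<^sup>2 / 3) / 2 \<and> B \<bullet> C = - (s\<^sup>2 / 3) / 2 \<and> C \<bullet> A = - (s\<^sup>2 / 3) / 2"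
    by (simp add: inner_add_right inner_diff_left inner_diff_right inner_commute)
  then show ?thesis
    using sum0 normal \<open>s > 0\<close> \<open>p \<noteq> M\<close> unfolding equilateral_frame_def ABC by auto
qed

theorem theorem2:
  fixes T F :: "(real^3) set" and p q :: "real^3" and r R d :: real
  assumes "3 simplex T"
    and "is_insphere T p r"
    and "is_circumsphere T q R"
    and "d = dist p q"
    and "F facet_of T"
    and "equilateral_triangle F"
    and "touches_face_at p r F (centroid F)"
  shows "R^2 - d^2 - 3 * r^2 - 2 * r * R = 0"
proof -
  obtain S where S: "\<not> affine_dependent S" "int (card S) = 3 + 1" "T = convex hull S"
    using assms(1) unfolding simplex_def by blast
  obtain e where e: "e \<in> S" "F = convex hull (S - {e})"
    using assms(5) S by (auto simp: facet_of_convex_hull_affine_independent)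
  have "card (S - {e}) = 3"
    using S(2) e(1) by simp
  then obtain a b c where abc: "S - {e} = {a, b, c}" "a \<noteq> b" "a \<noteq> c" "b \<noteq> c"
    by (auto simp: card_3_iff)
  have S_eq: "S = {a, b, c, e}" and neq_e: "e \<notin> {a, b, c}"
    using abc(1) e(1) by auto
  have vT: "vertices T = {a, b, c, e}"
    using S vertices_convex_hull_affine_independent S_eq by metis
  have F: "F = convex hull {a, b, c}"
    using e(2) abc(1) by simp
  have "\<not> affine_dependent {a, b, c}"
    using S(1) affine_independent_Diff abc(1) by metis
  then have vF: "vertices F = {a, b, c}"
    unfolding F by (rule vertices_convex_hull_affine_independent)

  define M where "M = centroid F"
  have M: "a + b + c = 3 *\<^sub>R M"
    unfolding M_def centroid_def vF using abc(2-4) by (simp add: add.assoc)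
  obtain s where "\<forall>x\<in>{a, b, c}. \<forall>y\<in>{a, b, c}. x \<noteq> y \<longrightarrow> dist x y = s"
    using assms(6) unfolding equilateral_triangle_def vF by blast
  then have s: "dist a b = s" "dist b c = s" "dist c a = s"
    using abc(2-4) by auto
  have "s > 0"
    using s(1) abc(2) by auto

  have touchF: "sphere p r \<inter> affine hull {a, b, c} = {M}"
    using assms(7) unfolding touches_face_at_def M_def F by simp
  have "r > 0"
    using assms(2) by (simp add: is_insphere_def)
  have "dist p M = r"
    using touchF by auto
  then have r: "r = norm (p - M)" and "p \<noteq> M"
    using \<open>r > 0\<close> by (auto simp: dist_norm)
  define w where "w = s\<^sup>2 / 3"
  have frame: "equilateral_frame w (a - M) (b - M) (c - M) (p - M)"
    unfolding w_def
  proof (rule equilateral_frame_centroid[OF M s \<open>s > 0\<close> \<open>p \<noteq> M\<close>])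
    fix x assume "x \<in> {a, b, c}"
    then have "(M - p) \<bullet> (x - M) = 0"
      by (intro tangent_plane_orthogonal_radius[OF touchF] hull_inc)
    then show "(x - M) \<bullet> (p - M) = 0"
      by (simp add: inner_diff_left inner_diff_right inner_commute)
  qed
  note frame' = equilateral_frame_rotate[OF frame]
  note frame'' = equilateral_frame_rotate[OF frame']

  have lateral: "\<exists>t. touches_face_at p r (convex hull (S - {v})) t" if "v \<in> {a, b, c}" for v
  proof -
    have "e \<in> S - {v}"
      using e(1) neq_e that by auto
    then have "convex hull (S - {v}) \<noteq> {}"
      by auto
    then have "convex hull (S - {v}) facet_of T"
      using that S S_eq by (auto simp: facet_of_convex_hull_affine_independent)
    then show ?thesis
      using assms(2) by (simp add: is_insphere_def)
  qed
  have faces: "S - {a} = {b, c, e}" "S - {b} = {c, a, e}" "S - {c} = {a, b, e}"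
    using S_eq abc(2-4) neq_e by auto
  obtain ta tb tc where t: "touches_face_at p r (convex hull {b, c, e}) ta"
      "touches_face_at p r (convex hull {c, a, e}) tb"
      "touches_face_at p r (convex hull {a, b, e}) tc"
    using lateral faces by (metis insertI1 insertI2)
  have indep: "\<not> affine_dependent {a, b, c, e}" "\<not> affine_dependent {b, c, a, e}"
      "\<not> affine_dependent {c, a, b, e}"
    using S(1) S_eq by (simp_all add: insert_commute)
  define D where "D = e - M"
  define P where "P = p - M"
  have sums: "b + c + a = 3 *\<^sub>R M" "c + a + b = 3 *\<^sub>R M"
    using M by (simp_all add: ac_simps)
  have eqs: "4 * r\<^sup>2 * (D \<bullet> x) = (w - 4 * r\<^sup>2) * (D \<bullet> P) - 2 * w * r\<^sup>2"
    if "x \<in> {a - M, b - M, c - M}" for x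
    using that abc(2-4) neq_e
      insphere_lateral_face(1)[OF indep(1) _ M frame r t(1)]
      insphere_lateral_face(1)[OF indep(2) _ sums(1) frame' r t(2)]
      insphere_lateral_face(1)[OF indep(3) _ sums(2) frame'' r t(3)]
    unfolding D_def P_def by auto
  have DP: "D \<bullet> P > 0"
    using insphere_lateral_face(2)[OF indep(1) _ M frame r t(1)] abc(2-4) neq_e
    unfolding D_def P_def by auto
  have PP: "P \<bullet> P = r\<^sup>2"
    by (simp add: P_def r power2_norm_eq_inner)
  have P0: "(a - M) \<bullet> P = 0" and AA: "(a - M) \<bullet> (a - M) = w" and "w > 0"
    using frame by (auto simp: equilateral_frame_def P_def)

  define h where "h = D \<bullet> P / (P \<bullet> P)"
  have "4 * r\<^sup>2 * (D \<bullet> (a - M)) = 4 * r\<^sup>2 * (D \<bullet> (b - M))"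
      "4 * r\<^sup>2 * (D \<bullet> (b - M)) = 4 * r\<^sup>2 * (D \<bullet> (c - M))"
    by (simp_all only: eqs insert_iff simp_thms)
  then have "D = h *\<^sub>R P"
    using \<open>r > 0\<close> equidistant_on_axis[OF frame, of D] unfolding h_def P_def by simp
  have "h > 0"
    using DP PP \<open>r > 0\<close> by (simp add: h_def)

  define Q where "Q = q - M"
  define k where "k = Q \<bullet> P / (P \<bullet> P)"
  have R: "norm (x - Q) = R" if "x + M \<in> {a, b, c, e}" for x
  proof -
    have "dist q (x + M) = R"
      using assms(3) that unfolding is_circumsphere_def vT by auto
    moreover have "q - (x + M) = - (x - Q)"
      by (simp add: Q_def)
    ultimately show ?thesis
      by (metis dist_norm norm_minus_cancel)
  qed
  have R2: "R\<^sup>2 = x \<bullet> x - 2 * (Q \<bullet> x) + Q \<bullet> Q" if "x + M \<in> {a, b, c, e}" for x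
    using R[OF that, symmetric]
    by (simp add: power2_norm_eq_inner inner_diff_left inner_diff_right inner_commute)
  have "Q \<bullet> (a - M) = Q \<bullet> (b - M)" "Q \<bullet> (b - M) = Q \<bullet> (c - M)"
    using R2[of "a - M"] R2[of "b - M"] R2[of "c - M"] frame by (auto simp: equilateral_frame_def)
  then have "Q = k *\<^sub>R P"
    using equidistant_on_axis[OF frame, of Q] unfolding k_def P_def by simp

  show ?thesis
  proof (rule regular_pyramid_gap_eq_0[OF \<open>r > 0\<close> \<open>w > 0\<close> \<open>h > 0\<close>])
    show "R \<ge> 0"
      using R[of "a - M"] by auto
    have "D \<bullet> (a - M) = 0" "D \<bullet> P = h * r\<^sup>2"
      using P0 PP \<open>D = h *\<^sub>R P\<close> by (simp_all add: inner_commute)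
    then have "(w - 4 * r\<^sup>2) * (h * r\<^sup>2) = 2 * w * r\<^sup>2"
      using eqs[of "a - M"] by simp
    then have "((w - 4 * r\<^sup>2) * h) * r\<^sup>2 = (2 * w) * r\<^sup>2"
      by (simp only: mult.assoc)
    moreover have "r\<^sup>2 \<noteq> 0"
      using \<open>r > 0\<close> by simp
    ultimately show "(w - 4 * r\<^sup>2) * h = 2 * w"
      by (metis mult_right_cancel)
    show "R\<^sup>2 = w + k\<^sup>2 * r\<^sup>2"
      using R2[of "a - M"] P0 AA \<open>Q = k *\<^sub>R P\<close> PP
      by (simp add: inner_commute power2_eq_square)
    have "D - Q = (h - k) *\<^sub>R P"
      by (simp add: \<open>D = h *\<^sub>R P\<close> \<open>Q = k *\<^sub>R P\<close> scaleR_left_diff_distrib)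
    moreover have "norm (D - Q) = R"
      by (rule R) (simp add: D_def)
    ultimately show "R\<^sup>2 = (h - k)\<^sup>2 * r\<^sup>2"
      by (simp add: P_def r power_mult_distrib flip: \<open>norm (D - Q) = R\<close>)
    have "q - p = (k - 1) *\<^sub>R P"
      using \<open>Q = k *\<^sub>R P\<close> by (simp add: Q_def P_def algebra_simps)
    moreover have "d = norm (q - p)"
      by (simp add: assms(4) dist_norm norm_minus_commute)
    ultimately show "d\<^sup>2 = (k - 1)\<^sup>2 * r\<^sup>2"
      by (simp add: P_def r power_mult_distrib)
  qed
qed

end
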